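(* Let $D_m=\langle a,b\mid a^m=b^2=1,\ ab=ba^{-1}\rangle$ for $m\ge3$. (i) $\Gamma_N(D_4)\cong 2K_2$, and if $n=2^\alpha$ with $\alpha\ge3$ then $\Gamma_N(D_n)\cong 2\big(\Gamma_N(D_{n/2})+K_2\big)$. (ii) Let $p$ be an odd prime. Then $\Gamma_N(D_p)\cong\overline{K}_p$, and if $n=p^\alpha$ with $\alpha\ge2$ then $\Gamma_N(D_n)\cong p\big(\Gamma_N(D_{n/p})+K_1\big)$. (iii) If $n=2p$ with $p$ an odd prime, then $\Gamma_N(D_n)\cong pK_3$. (iv) If $n=pq$ with $p,q$ primes and $2<p<q$, then $\Gamma_N(D_n)$ is isomorphic to the graph with pairwise distinct vertices $u_1,\dots,u_p$, $v_1,\dots,v_q$, $w_{ij}$ ($1\le i\le p$, $1\le j\le q$), whose edge set is the union over all $i,j$ of the edges of the triangle (complete graph) on $\{u_i,v_j,w_{ij}\}$.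
   Context: $\Gamma_N(G)$ denotes the simple graph whose vertices are the proper non-normal subgroups of the group $G$, two distinct vertices $H,K$ being adjacent iff $HK=KH$. $K_m$ is the complete graph, $\overline{K}_m$ the edgeless graph on $m$ vertices, $mG$ the disjoint union of $m$ copies of $G$, and $G_1+G_2$ the join (disjoint union plus all edges between $G_1$ and $G_2$). *)

theory Defs
  imports
    "HOL-Algebra.Coset"
    "HOL-Computational_Algebra.Primes"
    "Graph_Theory.Pair_Digraph"
    "Graph_Theory.Digraph_Isomorphism"
begin

section \<open>Groups given by generators and relations\<close>

text \<open>
  The letter \<open>(g, True)\<close> stands for the generator \<open>g\<close>, the letter \<open>(g, False)\<close> for
  its formal inverse.
\<close>

type_synonym 'g word = "('g \<times> bool) list"

text \<open>
  The least congruence on words (over all generators of type \<open>'g\<close>) that contains free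
  cancellation and all pairs \<open>(u, v)\<close> in \<open>R\<close>, each pair read as a relation \<open>u = v\<close>.
\<close>

inductive_set word_cong :: "('g word \<times> 'g word) set \<Rightarrow> ('g word \<times> 'g word) set"
  for R :: "('g word \<times> 'g word) set"
where
  rel: "(u, v) \<in> R \<Longrightarrow> (u, v) \<in> word_cong R"
| cancel: "([(g, s), (g, \<not> s)], []) \<in> word_cong R"
| app: "(u, v) \<in> word_cong R \<Longrightarrow> (u', v') \<in> word_cong R \<Longrightarrow> (u @ u', v @ v') \<in> word_cong R"
| refl: "(u, u) \<in> word_cong R"
| sym: "(u, v) \<in> word_cong R \<Longrightarrow> (v, u) \<in> word_cong R"
| trans: "(u, v) \<in> word_cong R \<Longrightarrow> (v, w) \<in> word_cong R \<Longrightarrow> (u, w) \<in> word_cong R"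

definition presented_group :: "('g word \<times> 'g word) set \<Rightarrow> 'g word set monoid" where
  "presented_group R =
    \<lparr> carrier = UNIV // word_cong R,
      monoid.mult = (\<lambda>X Y. \<Union>u\<in>X. \<Union>v\<in>Y. word_cong R `` {u @ v}),
      one = word_cong R `` {[]} \<rparr>"

lemma equiv_word_cong: "equiv UNIV (word_cong R)"
  by (intro equivI refl_onI symI transI) (auto intro: word_cong.intros)

lemma presented_group_mult_class:
  "word_cong R `` {u} \<otimes>\<^bsub>presented_group R\<^esub> word_cong R `` {v} = word_cong R `` {u @ v}"
proof -
  have "congruent2 (word_cong R) (word_cong R) (\<lambda>u v. word_cong R `` {u @ v})"
    unfolding congruent2_def
    by (auto intro!: equiv_class_eq[OF equiv_word_cong] word_cong.app)
  from UN_equiv_class2[OF equiv_word_cong equiv_word_cong this]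
  show ?thesis by (simp add: presented_group_def)
qed

lemma word_cong_inverse:
  "(rev (map (\<lambda>(g, s). (g, \<not> s)) u) @ u, []) \<in> word_cong R"
proof (induction u)
  case Nil
  show ?case by (simp add: word_cong.refl)
next
  case (Cons x u)
  let ?i = "rev (map (\<lambda>(g, s). (g, \<not> s)) u)"
  obtain g s where x: "x = (g, s)" by (cases x)
  have c: "([(g, \<not> s), (g, s)], []) \<in> word_cong R"
    using word_cong.cancel[of g "\<not> s" R] by simp
  have "(?i @ ([(g, \<not> s), (g, s)] @ u), ?i @ ([] @ u)) \<in> word_cong R"
    by (intro word_cong.app word_cong.refl c)
  then have "(?i @ [(g, \<not> s), (g, s)] @ u, []) \<in> word_cong R"
    using Cons.IH by (auto intro: word_cong.trans)
  then show ?case by (simp add: x)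
qed

lemma group_presented_group: "group (presented_group R)"
proof (rule groupI)
  let ?G = "presented_group R"
  have carr: "\<exists>u. X = word_cong R `` {u}" if "X \<in> carrier ?G" for X
    using that by (auto simp: presented_group_def elim: quotientE)
  have cls: "word_cong R `` {u} \<in> carrier ?G" for u
    by (simp add: presented_group_def quotientI)
  have one: "\<one>\<^bsub>?G\<^esub> = word_cong R `` {[]}"
    by (simp add: presented_group_def)
  show "\<one>\<^bsub>?G\<^esub> \<in> carrier ?G"
    by (simp add: one cls)
  show "X \<otimes>\<^bsub>?G\<^esub> Y \<in> carrier ?G" if "X \<in> carrier ?G" "Y \<in> carrier ?G" for X Y
    using carr[OF that(1)] carr[OF that(2)] by (auto simp: presented_group_mult_class cls)
  show "X \<otimes>\<^bsub>?G\<^esub> Y \<otimes>\<^bsub>?G\<^esub> Z = X \<otimes>\<^bsub>?G\<^esub> (Y \<otimes>\<^bsub>?G\<^esub> Z)"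
    if "X \<in> carrier ?G" "Y \<in> carrier ?G" "Z \<in> carrier ?G" for X Y Z
    using carr[OF that(1)] carr[OF that(2)] carr[OF that(3)]
    by (auto simp: presented_group_mult_class)
  show "\<one>\<^bsub>?G\<^esub> \<otimes>\<^bsub>?G\<^esub> X = X" if "X \<in> carrier ?G" for X
    using carr[OF that] by (auto simp: presented_group_mult_class one)
  show "\<exists>Y\<in>carrier ?G. Y \<otimes>\<^bsub>?G\<^esub> X = \<one>\<^bsub>?G\<^esub>" if X: "X \<in> carrier ?G" for X
  proof -
    obtain u where u: "X = word_cong R `` {u}" using carr[OF X] by blast
    have "word_cong R `` {rev (map (\<lambda>(g, s). (g, \<not> s)) u)} \<otimes>\<^bsub>?G\<^esub> X = \<one>\<^bsub>?G\<^esub>"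
      unfolding u presented_group_mult_class one
      by (rule equiv_class_eq[OF equiv_word_cong word_cong_inverse])
    then show ?thesis using cls by blast
  qed
qed

datatype dihedral_gen = gen_a | gen_b

text \<open>\<open>\<langle>a, b | a\<^sup>m = b\<^sup>2 = 1, ab = ba\<^sup>-\<^sup>1\<rangle>\<close>\<close>

definition dihedral :: "nat \<Rightarrow> dihedral_gen word set monoid" where
  "dihedral m = presented_group
    {(replicate m (gen_a, True), []),
     (replicate 2 (gen_b, True), []),
     ([(gen_a, True), (gen_b, True)], [(gen_b, True), (gen_a, False)])}"


section \<open>Simple graphs\<close>

text \<open>
  A simple graph is a symmetric loopfree pair digraph: the edge \<open>{u, v}\<close> is represented
  by the two arcs \<open>(u, v)\<close> and \<open>(v, u)\<close>.
\<close>

abbreviation graph_iso :: "'a pair_pre_digraph \<Rightarrow> 'b pair_pre_digraph \<Rightarrow> bool"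
  (infix \<open>\<simeq>\<close> 50) where
  "G \<simeq> H \<equiv> digraph_iso (with_proj G) (with_proj H)"

definition complete_graph_on :: "'a set \<Rightarrow> 'a pair_pre_digraph" where
  "complete_graph_on S = \<lparr> pverts = S, parcs = {(x, y). x \<in> S \<and> y \<in> S \<and> x \<noteq> y} \<rparr>"

definition complete_graph :: "nat \<Rightarrow> nat pair_pre_digraph" where
  "complete_graph m = complete_graph_on {1..m}"

definition edgeless_graph :: "nat \<Rightarrow> nat pair_pre_digraph" where
  "edgeless_graph m = \<lparr> pverts = {1..m}, parcs = {} \<rparr>"

definition graph_copies :: "nat \<Rightarrow> 'a pair_pre_digraph \<Rightarrow> (nat \<times> 'a) pair_pre_digraph" where
  "graph_copies m G =
    \<lparr> pverts = {1..m} \<times> pverts G,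
      parcs = {((i, x), (j, y)). i \<in> {1..m} \<and> i = j \<and> (x, y) \<in> parcs G} \<rparr>"

definition graph_join ::
  "'a pair_pre_digraph \<Rightarrow> 'b pair_pre_digraph \<Rightarrow> ('a + 'b) pair_pre_digraph" where
  "graph_join G H =
    \<lparr> pverts = pverts G <+> pverts H,
      parcs = {(Inl x, Inl y) | x y. (x, y) \<in> parcs G}
            \<union> {(Inr x, Inr y) | x y. (x, y) \<in> parcs H}
            \<union> {(Inl x, Inr y) | x y. x \<in> pverts G \<and> y \<in> pverts H}
            \<union> {(Inr y, Inl x) | x y. x \<in> pverts G \<and> y \<in> pverts H} \<rparr>"

datatype triangle_vertex = vertex_u nat | vertex_v nat | vertex_w nat nat

definition triangles_graph :: "nat \<Rightarrow> nat \<Rightarrow> triangle_vertex pair_pre_digraph" where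
  "triangles_graph p q =
    \<lparr> pverts = vertex_u ` {1..p} \<union> vertex_v ` {1..q}
             \<union> {vertex_w i j | i j. i \<in> {1..p} \<and> j \<in> {1..q}},
      parcs = (\<Union>i\<in>{1..p}. \<Union>j\<in>{1..q}.
                 parcs (complete_graph_on {vertex_u i, vertex_v j, vertex_w i j})) \<rparr>"

definition nonnormal_permutability_graph ::
  "('a, 'b) monoid_scheme \<Rightarrow> 'a set pair_pre_digraph" where
  "nonnormal_permutability_graph G =
    (let V = {H. subgroup H G \<and> H \<noteq> carrier G \<and> \<not> H \<lhd> G}
     in \<lparr> pverts = V,
          parcs = {(H, K). H \<in> V \<and> K \<in> V \<and> H \<noteq> K \<and> H <#>\<^bsub>G\<^esub> K = K <#>\<^bsub>G\<^esub> H} \<rparr>)"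

end

theory Submission
  imports Defs "HOL-Number_Theory.Cong"
begin

text \<open>
  A subgroup of the dihedral group of order \<open>2n\<close> that contains a reflection is
  \<open>H(d, i) = \<langle>a\<^sup>d, a\<^sup>i b\<rangle>\<close> with \<open>d\<close> dividing \<open>n\<close> and \<open>i\<close> a residue modulo \<open>d\<close>; all
  other subgroups consist of rotations and are normal, and \<open>H(d, i)\<close> is normal iff
  \<open>d\<close> divides 2. The rotations in \<open>H(d, i) H(e, j)\<close> have exponents in \<open>g\<int> \<union> (i - j + g\<int>)\<close>,
  where \<open>g = gcd(d, e)\<close>, while its reflections do not depend on the order of the factors. So
  \<open>H(d, i)\<close> and \<open>H(e, j)\<close> permute iff \<open>g\<close> divides \<open>2 (i - j)\<close>, and everything reduces to a graph
  on pairs \<open>(d, i)\<close>. If all \<open>d\<close> are multiples of \<open>p\<close>, this graph splits according to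
  \<open>i mod p\<close> into \<open>p\<close> copies of the graph with every \<open>d\<close> divided by \<open>p\<close>, and the vertices with
  \<open>d \<le> 2\<close> that can arise there are adjacent to all others.
\<close>

section \<open>Isomorphisms of simple graphs\<close>

text \<open>In a pair digraph an arc is the pair of its end points, so a vertex bijection that
  preserves and reflects adjacency carries the arcs along by \<open>map_prod f f\<close>; the record
  \<open>?h\<close> packages both maps.\<close>

lemma graph_isoI:
  assumes "pair_wf_digraph G" "pair_wf_digraph H" "bij_betw f (pverts G) (pverts H)"
    and arcs: "\<And>u v. u \<in> pverts G \<Longrightarrow> v \<in> pverts G \<Longrightarrow>
      (f u, f v) \<in> parcs H \<longleftrightarrow> (u, v) \<in> parcs G"
  shows "G \<simeq> H"
proof -
  interpret G: pair_wf_digraph G by fact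
  interpret H: pair_wf_digraph H by fact
  let ?h = "\<lparr>iso_verts = f, iso_arcs = map_prod f f, iso_head = snd, iso_tail = fst\<rparr>"
  have inj: "inj_on f (pverts G)" and im: "f ` pverts G = pverts H"
    using assms(3) by (auto simp: bij_betw_def)
  have sub: "parcs G \<subseteq> pverts G \<times> pverts G"
    using G.wellformed' by auto
  have "map_prod f f ` parcs G = parcs H"
  proof
    show "map_prod f f ` parcs G \<subseteq> parcs H"
      using arcs G.wellformed' by auto
    show "parcs H \<subseteq> map_prod f f ` parcs G"
    proof
      fix e assume e: "e \<in> parcs H"
      then obtain u v where "e = (f u, f v)" "u \<in> pverts G" "v \<in> pverts G"
        using H.wellformed' im by (metis imageE prod.collapse)
      with e arcs show "e \<in> map_prod f f ` parcs G" by force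
    qed
  qed
  moreover have "inj_on (map_prod f f) (parcs G)"
    by (rule inj_on_subset[OF map_prod_inj_on[OF inj inj] sub])
  ultimately show ?thesis
    unfolding digraph_iso_def pre_digraph.digraph_isomorphism_def
    using inj im G.wf_digraph by (intro exI[of _ ?h]) (auto simp: app_iso_def with_proj_def)
qed

text \<open>Unpacking an isomorphism also yields well-formedness of both graphs, so that symmetry,
  transitivity and the congruence rules below hold without side conditions.\<close>

lemma graph_isoE:
  assumes "G \<simeq> H"
  obtains f where "pair_wf_digraph G" "pair_wf_digraph H" "bij_betw f (pverts G) (pverts H)"
    "\<And>u v. u \<in> pverts G \<Longrightarrow> v \<in> pverts G \<Longrightarrow> (f u, f v) \<in> parcs H \<longleftrightarrow> (u, v) \<in> parcs G"
proof -
  obtain h where h: "pre_digraph.digraph_isomorphism (with_proj G) h"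
    and H: "with_proj H = app_iso h (with_proj G)"
    using assms by (auto simp: digraph_iso_def)
  let ?f = "iso_verts h"
  have wf: "wf_digraph (with_proj G)" and inj: "inj_on ?f (pverts G)"
    using h by (auto simp: pre_digraph.digraph_isomorphism_def)
  have sub: "\<And>u v. (u, v) \<in> parcs G \<Longrightarrow> u \<in> pverts G \<and> v \<in> pverts G"
    using wf by (force simp: wf_digraph_def)
  have vH: "pverts H = ?f ` pverts G" and aH: "parcs H = iso_arcs h ` parcs G"
    and t: "iso_tail h = fst" "iso_head h = snd"
    using H by (auto simp: with_proj_def app_iso_def)
  \<comment> \<open>The heads and tails in both graphs are the two projections, so the action of
    \<open>h\<close> on an arc is determined by its action on the end points.\<close>
  have "iso_arcs h e = map_prod ?f ?f e" if "e \<in> parcs G" for e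
    using h that t by (auto simp: pre_digraph.digraph_isomorphism_def prod_eq_iff)
  then have aH': "parcs H = map_prod ?f ?f ` parcs G"
    using aH by (auto simp: image_def)
  show ?thesis
  proof (rule that[of ?f])
    show "pair_wf_digraph G" "pair_wf_digraph H"
      using sub by (auto simp: pair_wf_digraph_def aH' vH)
    show "bij_betw ?f (pverts G) (pverts H)"
      using inj vH by (simp add: bij_betw_def)
    show "(?f u, ?f v) \<in> parcs H \<longleftrightarrow> (u, v) \<in> parcs G"
      if uv: "u \<in> pverts G" "v \<in> pverts G" for u v
    proof
      assume "(?f u, ?f v) \<in> parcs H"
      then obtain x y where "(x, y) \<in> parcs G" "?f u = ?f x" "?f v = ?f y"
        by (auto simp: aH')
      then show "(u, v) \<in> parcs G"
        using uv sub inj by (metis inj_onD)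
    qed (force simp: aH')
  qed
qed

lemma graph_iso_sym:
  assumes "G \<simeq> H"
  shows "H \<simeq> G"
proof -
  obtain f where f: "pair_wf_digraph G" "pair_wf_digraph H" "bij_betw f (pverts G) (pverts H)"
    "\<And>u v. u \<in> pverts G \<Longrightarrow> v \<in> pverts G \<Longrightarrow> (f u, f v) \<in> parcs H \<longleftrightarrow> (u, v) \<in> parcs G"
    using assms by (rule graph_isoE) blast
  let ?g = "inv_into (pverts G) f"
  have g: "bij_betw ?g (pverts H) (pverts G)"
    by (rule bij_betw_inv_into[OF f(3)])
  show ?thesis
  proof (rule graph_isoI[OF f(2,1) g])
    fix u v assume "u \<in> pverts H" "v \<in> pverts H"
    then show "(?g u, ?g v) \<in> parcs G \<longleftrightarrow> (u, v) \<in> parcs H"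
      using f(4)[of "?g u" "?g v"] f(3) g
      by (simp add: bij_betw_inv_into_right bij_betwE)
  qed
qed

lemma graph_iso_trans:
  assumes "G \<simeq> H" "H \<simeq> K"
  shows "G \<simeq> K"
proof -
  obtain f where f: "pair_wf_digraph G" "bij_betw f (pverts G) (pverts H)"
    "\<And>u v. u \<in> pverts G \<Longrightarrow> v \<in> pverts G \<Longrightarrow> (f u, f v) \<in> parcs H \<longleftrightarrow> (u, v) \<in> parcs G"
    using assms(1) by (rule graph_isoE) blast
  obtain g where g: "pair_wf_digraph K" "bij_betw g (pverts H) (pverts K)"
    "\<And>u v. u \<in> pverts H \<Longrightarrow> v \<in> pverts H \<Longrightarrow> (g u, g v) \<in> parcs K \<longleftrightarrow> (u, v) \<in> parcs H"
    using assms(2) by (rule graph_isoE) blast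
  show ?thesis
    by (rule graph_isoI[OF f(1) g(1) bij_betw_trans[OF f(2) g(2)]])
      (use f g in \<open>auto dest: bij_betwE\<close>)
qed

section \<open>Compatibility of isomorphism with copies and joins; complete graphs\<close>

lemma graph_copies_cong:
  assumes "G \<simeq> H"
  shows "graph_copies m G \<simeq> graph_copies m H"
proof -
  obtain f where f: "pair_wf_digraph G" "pair_wf_digraph H" "bij_betw f (pverts G) (pverts H)"
    "\<And>u v. u \<in> pverts G \<Longrightarrow> v \<in> pverts G \<Longrightarrow> (f u, f v) \<in> parcs H \<longleftrightarrow> (u, v) \<in> parcs G"
    using assms by (rule graph_isoE) blast
  show ?thesis
  proof (rule graph_isoI)
    show "pair_wf_digraph (graph_copies m G)" "pair_wf_digraph (graph_copies m H)"
      using f(1,2) by (fastforce simp: pair_wf_digraph_def graph_copies_def)+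
    show "bij_betw (map_prod id f) (pverts (graph_copies m G)) (pverts (graph_copies m H))"
      using f(3) by (auto simp: graph_copies_def intro: bij_betw_map_prod)
  qed (use f(4) in \<open>auto simp: graph_copies_def\<close>)
qed

lemma graph_join_cong:
  assumes "G \<simeq> G'" "H \<simeq> H'"
  shows "graph_join G H \<simeq> graph_join G' H'"
proof -
  obtain f where f: "pair_wf_digraph G" "pair_wf_digraph G'" "bij_betw f (pverts G) (pverts G')"
    "\<And>u v. u \<in> pverts G \<Longrightarrow> v \<in> pverts G \<Longrightarrow> (f u, f v) \<in> parcs G' \<longleftrightarrow> (u, v) \<in> parcs G"
    using assms(1) by (rule graph_isoE) blast
  obtain g where g: "pair_wf_digraph H" "pair_wf_digraph H'" "bij_betw g (pverts H) (pverts H')"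
    "\<And>u v. u \<in> pverts H \<Longrightarrow> v \<in> pverts H \<Longrightarrow> (g u, g v) \<in> parcs H' \<longleftrightarrow> (u, v) \<in> parcs H"
    using assms(2) by (rule graph_isoE) blast
  show ?thesis
  proof (rule graph_isoI)
    show "pair_wf_digraph (graph_join G H)" "pair_wf_digraph (graph_join G' H')"
      using f(1,2) g(1,2) by (fastforce simp: pair_wf_digraph_def graph_join_def)+
    show "bij_betw (map_sum f g) (pverts (graph_join G H)) (pverts (graph_join G' H'))"
    proof -
      have inj: "inj_on f (pverts G)" "inj_on g (pverts H)"
        and im: "f ` pverts G = pverts G'" "g ` pverts H = pverts H'"
        using f(3) g(3) by (auto simp: bij_betw_def)
      have "inj_on (map_sum f g) (pverts G <+> pverts H)"
        by (rule inj_onI) (use inj in \<open>auto elim!: PlusE dest: inj_onD\<close>)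
      moreover have "map_sum f g ` (pverts G <+> pverts H) = pverts G' <+> pverts H'"
        by (simp add: Plus_def image_Un image_image flip: im)
      ultimately show ?thesis by (simp add: bij_betw_def graph_join_def)
    qed
    fix u v assume "u \<in> pverts (graph_join G H)" "v \<in> pverts (graph_join G H)"
    then show "(map_sum f g u, map_sum f g v) \<in> parcs (graph_join G' H') \<longleftrightarrow>
        (u, v) \<in> parcs (graph_join G H)"
      using f(4) g(4) bij_betwE[OF f(3)] bij_betwE[OF g(3)]
      by (cases u; cases v) (simp_all add: graph_join_def Plus_def image_iff)
  qed
qed

lemma pair_wf_complete_graph_on: "pair_wf_digraph (complete_graph_on S)"
  by (auto simp: pair_wf_digraph_def complete_graph_on_def)

lemma complete_graph_on_iso:
  assumes "finite S" "card S = m"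
  shows "complete_graph_on S \<simeq> complete_graph m"
proof -
  obtain f where f: "bij_betw f S {1..m}"
    using assms finite_same_card_bij[of S "{1..m}"] by auto
  show ?thesis
    unfolding complete_graph_def
    by (rule graph_isoI[OF pair_wf_complete_graph_on pair_wf_complete_graph_on, of f])
      (use f in \<open>auto simp: complete_graph_on_def bij_betw_def inj_on_def\<close>)
qed

lemma pair_wf_nonnormal_permutability_graph:
  "pair_wf_digraph (nonnormal_permutability_graph G)"
  by (auto simp: pair_wf_digraph_def nonnormal_permutability_graph_def Let_def)

section \<open>Graphs of residue classes\<close>

text \<open>The vertex \<open>(d, i)\<close> will stand for H(d, i). Arbitrary sets \<open>D\<close>
  are allowed because the reduction passes through the moduli 1 and 2, to which no non-normal
  subgroup belongs.\<close>

definition residue_graph :: "nat set \<Rightarrow> (nat \<times> nat) pair_pre_digraph" where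
  "residue_graph D =
    (let V = SIGMA d:D. {..<d}
     in \<lparr> pverts = V,
          parcs = {((d, i), (e, j)) | d i e j. (d, i) \<in> V \<and> (e, j) \<in> V \<and> (d, i) \<noteq> (e, j) \<and>
                     int (gcd d e) dvd 2 * (int i - int j)} \<rparr>)"

lemma pverts_residue_graph: "pverts (residue_graph D) = (SIGMA d:D. {..<d})"
  by (simp add: residue_graph_def Let_def)

lemma parcs_residue_graph:
  "((d, i), (e, j)) \<in> parcs (residue_graph D) \<longleftrightarrow>
    d \<in> D \<and> i < d \<and> e \<in> D \<and> j < e \<and> (d, i) \<noteq> (e, j) \<and>
    int (gcd d e) dvd 2 * (int i - int j)"
  by (auto simp: residue_graph_def Let_def)

lemma pair_wf_residue_graph: "pair_wf_digraph (residue_graph D)"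
  by (auto simp: pair_wf_digraph_def residue_graph_def Let_def)

section \<open>Decompositions of residue graphs\<close>

lemma odd_dvd_double_iff:
  assumes "odd p"
  shows "int p dvd 2 * x \<longleftrightarrow> int p dvd x"
  using assms by (intro coprime_dvd_mult_right_iff) simp

text \<open>The remainder i mod p names the copy, the quotient i div p the vertex in it. Edges stay
  inside a copy because adjacency forces p to divide i - j: by coprimality with 2 if p is odd, and
  by the spare factor 2 in the gcd of two even moduli otherwise. Inside a copy, i - j is p times the
  difference of the quotients, and p cancels from the divisibility.\<close>

lemma residue_graph_scale:
  assumes p: "p > 0" "odd p \<or> (\<forall>d\<in>D. even d)"
  shows "residue_graph ((*) p ` D) \<simeq> graph_copies p (residue_graph D)"
proof -
  \<comment> \<open>Copies are numbered from 1, hence the \<open>+ 1\<close> here and the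
    \<open>c - 1\<close> in the inverse.\<close>
  let ?f = "\<lambda>(d, i). (i mod p + 1, d div p, i div p)"
  let ?g = "\<lambda>(c, d, i). (p * d, p * i + c - 1)"
  show ?thesis
  proof (rule graph_isoI)
    show "bij_betw ?f (pverts (residue_graph ((*) p ` D))) (pverts (graph_copies p (residue_graph D)))"
    proof (rule bij_betw_byWitness[where f' = ?g], goal_cases)
      case 1
      show ?case using p by (auto simp: pverts_residue_graph)
    next
      case 2
      have "(p * i + c - 1) mod p + 1 = c" "(p * i + c - 1) div p = i"
        if "c \<in> {1..p}" for i c
      proof -
        obtain b where "c = Suc b" "b < p" using \<open>c \<in> {1..p}\<close> by (cases c) auto
        then show "(p * i + c - 1) mod p + 1 = c" "(p * i + c - 1) div p = i"
          by simp_all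
      qed
      then show ?case using p by (auto simp: pverts_residue_graph graph_copies_def)
    next
      case 3
      show ?case using p by (auto simp: pverts_residue_graph graph_copies_def Suc_le_eq less_mult_imp_div_less mult.commute)
    next
      case 4
      have "p * i + c - 1 < p * d" if "i < d" "c \<le> p" "1 \<le> c" for i c d
      proof -
        have "p * i + c - 1 < p * (i + 1)" using that by simp
        also have "\<dots> \<le> p * d" using that by (intro mult_left_mono) auto
        finally show ?thesis .
      qed
      then show ?case by (fastforce simp: pverts_residue_graph graph_copies_def)
    qed
    fix u v
    assume "u \<in> pverts (residue_graph ((*) p ` D))" "v \<in> pverts (residue_graph ((*) p ` D))"
    then obtain d i e j where uv: "u = (p * d, i)" "v = (p * e, j)" "d \<in> D" "e \<in> D"
      "i < p * d" "j < p * e"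
      by (auto simp: pverts_residue_graph)
    let ?g = "gcd d e"
    have lt: "i div p < d" "j div p < e"
      using uv by (simp_all add: less_mult_imp_div_less mult.commute)
    have *: "int i - int j = int p * (int (i div p) - int (j div p)) + (int (i mod p) - int (j mod p))"
      by (simp add: algebra_simps flip: of_nat_mult of_nat_add) 
    have eq: "i mod p = j mod p" if "int (p * ?g) dvd 2 * (int i - int j)"
    proof -
      have "int p dvd int i - int j"
      proof (cases "odd p")
        case True
        moreover have "int p dvd 2 * (int i - int j)"
          using that by (metis dvd_mult_left of_nat_mult)
        ultimately show ?thesis using odd_dvd_double_iff by blast
      next
        case False
        \<comment> \<open>Here p is even, so both moduli are even by assumption, and the 2 in their
          gcd cancels against the 2 in front of i - j.\<close>
        then obtain h where "?g = 2 * h" using p uv(3,4) by (metis gcd_greatest dvdE)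
        then have "2 * (int p * int h) dvd 2 * (int i - int j)"
          using that by (simp add: ac_simps)
        then show ?thesis by (metis dvd_mult_left dvd_times_left_cancel_iff zero_neq_numeral)
      qed
      then have "int i mod int p = int j mod int p" by (simp add: mod_eq_dvd_iff)
      then show ?thesis by (metis of_nat_eq_iff of_nat_mod)
    qed
    have "int (p * ?g) dvd 2 * (int i - int j) \<longleftrightarrow>
        int ?g dvd 2 * (int (i div p) - int (j div p))" if "i mod p = j mod p"
    proof -
      have "2 * (int i - int j) = int p * (2 * (int (i div p) - int (j div p)))"
        using * that by simp
      then show ?thesis using p(1) by simp
    qed
    moreover have "i = j \<longleftrightarrow> i div p = j div p" if "i mod p = j mod p"
      using that by (metis div_mod_decomp)
    ultimately show "(?f u, ?f v) \<in> parcs (graph_copies p (residue_graph D)) \<longleftrightarrow>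
        (u, v) \<in> parcs (residue_graph ((*) p ` D))"
      using uv lt eq p(1)
      by (auto simp: graph_copies_def parcs_residue_graph Suc_le_eq gcd_mult_distrib_nat[symmetric])
  qed (use pair_wf_residue_graph[of D] pair_wf_residue_graph in \<open>fastforce simp: pair_wf_digraph_def graph_copies_def\<close>)+
qed

text \<open>Since k divides 2, every gcd with k divides all even numbers: the k vertices of modulus
  k are adjacent to one another and to all the others.\<close>

lemma residue_graph_insert:
  assumes k: "k = 1 \<or> k = 2" and D: "k \<notin> D"
  shows "residue_graph (insert k D) \<simeq> graph_join (residue_graph D) (complete_graph k)"
proof (rule graph_isoI)
  let ?f = "\<lambda>(d, i). if d = k then Inr (i + 1) else Inl (d, i)"
  show "bij_betw ?f (pverts (residue_graph (insert k D)))
    (pverts (graph_join (residue_graph D) (complete_graph k)))"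
  proof (rule bij_betw_byWitness[where f' = "case_sum id (\<lambda>i. (k, i - 1))"], goal_cases)
    case 1 show ?case by auto
  next
    case 2 show ?case using D by (auto simp: graph_join_def pverts_residue_graph complete_graph_def complete_graph_on_def)
  next
    case 3 show ?case by (auto simp: graph_join_def pverts_residue_graph complete_graph_def complete_graph_on_def)
  next
    case 4 show ?case by (auto simp: graph_join_def pverts_residue_graph complete_graph_def complete_graph_on_def)
  qed
  have g: "int (gcd k d) dvd 2 * x" "int (gcd d k) dvd 2 * x" for d x
  proof -
    have "int k dvd 2 * x" using k by auto
    moreover have "int (gcd k d) dvd int k" "int (gcd d k) dvd int k"
      by (simp_all only: of_nat_dvd_iff gcd_dvd1 gcd_dvd2)
    ultimately show "int (gcd k d) dvd 2 * x" "int (gcd d k) dvd 2 * x" by (blast intro: dvd_trans)+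
  qed
  fix u v assume "u \<in> pverts (residue_graph (insert k D))" "v \<in> pverts (residue_graph (insert k D))"
  then obtain d i e j where uv: "u = (d, i)" "v = (e, j)" "d \<in> insert k D" "e \<in> insert k D"
    "i < d" "j < e"
    by (auto simp: pverts_residue_graph)
  then show "(?f u, ?f v) \<in> parcs (graph_join (residue_graph D) (complete_graph k)) \<longleftrightarrow>
      (u, v) \<in> parcs (residue_graph (insert k D))"
    using g(1)[of e] g(2)[of d] D
    by (cases "d = k"; cases "e = k")
      (simp_all add: graph_join_def pverts_residue_graph parcs_residue_graph complete_graph_def
        complete_graph_on_def Suc_le_eq)
next
  show "pair_wf_digraph (graph_join (residue_graph D) (complete_graph k))"
    using pair_wf_residue_graph[of D] pair_wf_complete_graph_on[of "{1..k}"]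
    by (fastforce simp: pair_wf_digraph_def graph_join_def complete_graph_def)
qed (rule pair_wf_residue_graph)

text \<open>All gcds divide 2, so any two vertices are adjacent; each modulus d contributes d
  vertices, whence the sum.\<close>

lemma residue_graph_complete:
  assumes "D \<subseteq> {1, 2}"
  shows "residue_graph D \<simeq> complete_graph (\<Sum>D)"
proof -
  have fin: "finite D" using assms finite_subset by auto
  have "int (gcd d e) dvd 2 * x" if "d \<in> D" "e \<in> D" for d e x
  proof -
    have "int d dvd 2" using that(1) assms by auto
    moreover have "int (gcd d e) dvd int d" by (simp only: of_nat_dvd_iff gcd_dvd1)
    ultimately show ?thesis by (meson dvd_mult2 dvd_trans)
  qed
  then have "residue_graph D = complete_graph_on (SIGMA d:D. {..<d})"
    by (auto simp: residue_graph_def complete_graph_on_def Let_def)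
  moreover have "card (SIGMA d:D. {..<d}) = \<Sum>D"
    using fin by simp
  ultimately show ?thesis
    using fin complete_graph_on_iso by (metis finite_SigmaI finite_lessThan)
qed

text \<open>For odd p the factor 2 cancels, and distinct residues below p are incongruent modulo
  p.\<close>

lemma residue_graph_odd_singleton:
  assumes "odd p"
  shows "residue_graph {p} \<simeq> edgeless_graph p"
proof (rule graph_isoI)
  show "bij_betw (\<lambda>(d, i). i + 1) (pverts (residue_graph {p})) (pverts (edgeless_graph p))"
    by (rule bij_betw_byWitness[where f' = "\<lambda>i. (p, i - 1)"])
      (auto simp: pverts_residue_graph edgeless_graph_def)
  fix u v assume "u \<in> pverts (residue_graph {p})" "v \<in> pverts (residue_graph {p})"
  then obtain i j where uv: "u = (p, i)" "v = (p, j)" "i < p" "j < p"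
    by (auto simp: pverts_residue_graph)
  have "i = j" if "int p dvd 2 * (int i - int j)"
  proof -
    have "int p dvd int i - int j"
      using that assms odd_dvd_double_iff by blast
    then have "int i mod int p = int j mod int p" by (simp add: mod_eq_dvd_iff)
    then show ?thesis using uv by simp
  qed
  then show "((case u of (d, i) \<Rightarrow> i + 1, case v of (d, i) \<Rightarrow> i + 1) \<in> parcs (edgeless_graph p)) \<longleftrightarrow>
      (u, v) \<in> parcs (residue_graph {p})"
    using uv by (auto simp: parcs_residue_graph edgeless_graph_def)
qed (auto simp: pair_wf_residue_graph, simp add: pair_wf_digraph_def edgeless_graph_def)

text \<open>By the Chinese remainder theorem a residue k modulo p * q is a pair of residues (i, j)
  modulo p and q. Its neighbours are exactly i modulo p and j modulo q, and these two are adjacent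
  because p and q are coprime: this is the triangle of \<open>vertex_u\<close>,
  \<open>vertex_v\<close> and \<open>vertex_w\<close>, with indices shifted by one.\<close>

lemma residue_graph_coprime:
  assumes pq: "odd p" "odd q" "coprime p q" "p > 1" "q > 1"
  shows "residue_graph {p, q, p * q} \<simeq> triangles_graph p q"
proof -
  let ?f = "\<lambda>(d, i). if d = p then vertex_u (i + 1) else if d = q then vertex_v (i + 1)
    else vertex_w (i mod p + 1) (i mod q + 1)"
  have ne: "p \<noteq> q" "p * q \<noteq> p" "p * q \<noteq> q" "q \<noteq> p" "p \<noteq> p * q" "q \<noteq> p * q" using pq by auto
  have pos: "p > 0" "q > 0" using pq by auto
  have mod_eq: "i mod m = j mod m" if "int m dvd 2 * (int i - int j)" "odd m" for i j m
    using that odd_dvd_double_iff by (metis mod_eq_dvd_iff of_nat_eq_iff of_nat_mod)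
  have dvd: "int m dvd 2 * (int i - int j) \<longleftrightarrow> i mod m = j mod m" if "odd m" for i j m
    using mod_eq[OF _ that] by (metis dvd_mult mod_eq_dvd_iff of_nat_mod)
  have crt: "i mod p = j mod p \<and> i mod q = j mod q \<longleftrightarrow> i = j" if "i < p * q" "j < p * q" for i j
  proof
    assume "i mod p = j mod p \<and> i mod q = j mod q"
    then have "int p dvd int i - int j" "int q dvd int i - int j"
      by (metis mod_eq_dvd_iff of_nat_mod)+
    then have "int (p * q) dvd int i - int j"
      using pq(3) by (simp add: divides_mult)
    then have "int i mod int (p * q) = int j mod int (p * q)" by (simp only: mod_eq_dvd_iff)
    then show "i = j" using that by (simp flip: of_nat_mult)
  qed simp
  have crt_ex: "\<exists>k < p * q. k mod p = i \<and> k mod q = j" if "i < p" "j < q" for i j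
  proof -
    obtain x where "[x = i] (mod p)" "[x = j] (mod q)"
      using binary_chinese_remainder_nat[OF pq(3)] by blast
    then show ?thesis using that pos
      by (intro exI[of _ "x mod (p * q)"]) (simp add: cong_def mod_mod_cancel)
  qed
  have arcs: "parcs (triangles_graph p q) = {(x, y). x \<noteq> y \<and>
      (\<exists>i\<in>{1..p}. \<exists>j\<in>{1..q}. x \<in> {vertex_u i, vertex_v j, vertex_w i j} \<and>
         y \<in> {vertex_u i, vertex_v j, vertex_w i j})}"
    unfolding triangles_graph_def complete_graph_on_def by simp blast
  \<comment> \<open>Each triangle has one vertex of each of the three kinds, so no edge joins two
    vertices of the same kind.\<close>
  have edges:
    "(vertex_u a, vertex_u b) \<in> parcs (triangles_graph p q) \<longleftrightarrow> False"
    "(vertex_v a, vertex_v b) \<in> parcs (triangles_graph p q) \<longleftrightarrow> False"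
    "(vertex_w a b, vertex_w c d) \<in> parcs (triangles_graph p q) \<longleftrightarrow> False"
    "(vertex_u a, vertex_v b) \<in> parcs (triangles_graph p q) \<longleftrightarrow> a \<in> {1..p} \<and> b \<in> {1..q}"
    "(vertex_v b, vertex_u a) \<in> parcs (triangles_graph p q) \<longleftrightarrow> a \<in> {1..p} \<and> b \<in> {1..q}"
    "(vertex_u c, vertex_w a b) \<in> parcs (triangles_graph p q) \<longleftrightarrow> c = a \<and> a \<in> {1..p} \<and> b \<in> {1..q}"
    "(vertex_w a b, vertex_u c) \<in> parcs (triangles_graph p q) \<longleftrightarrow> c = a \<and> a \<in> {1..p} \<and> b \<in> {1..q}"
    "(vertex_v c, vertex_w a b) \<in> parcs (triangles_graph p q) \<longleftrightarrow> c = b \<and> a \<in> {1..p} \<and> b \<in> {1..q}"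
    "(vertex_w a b, vertex_v c) \<in> parcs (triangles_graph p q) \<longleftrightarrow> c = b \<and> a \<in> {1..p} \<and> b \<in> {1..q}"
    for a b c d
    unfolding arcs by auto
  show ?thesis
  proof (rule graph_isoI)
    show "bij_betw ?f (pverts (residue_graph {p, q, p * q})) (pverts (triangles_graph p q))"
    proof (rule bij_betw_imageI)
      show "inj_on ?f (pverts (residue_graph {p, q, p * q}))"
        using crt ne by (auto simp: inj_on_def pverts_residue_graph)
      show "?f ` pverts (residue_graph {p, q, p * q}) = pverts (triangles_graph p q)"
      proof
        show "?f ` pverts (residue_graph {p, q, p * q}) \<subseteq> pverts (triangles_graph p q)"
          using ne pos by (auto simp: triangles_graph_def pverts_residue_graph Suc_le_eq)
        show "pverts (triangles_graph p q) \<subseteq> ?f ` pverts (residue_graph {p, q, p * q})"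
        proof
          fix x assume "x \<in> pverts (triangles_graph p q)"
          then consider i where "x = vertex_u i" "i \<in> {1..p}" | j where "x = vertex_v j" "j \<in> {1..q}"
            | i j where "x = vertex_w i j" "i \<in> {1..p}" "j \<in> {1..q}"
            by (auto simp: triangles_graph_def)
          then show "x \<in> ?f ` pverts (residue_graph {p, q, p * q})"
          proof cases
            case 1
            then show ?thesis
              by (intro image_eqI[of _ _ "(p, i - 1)"]) (auto simp: pverts_residue_graph)
          next
            case 2
            then show ?thesis using ne
              by (intro image_eqI[of _ _ "(q, j - 1)"]) (auto simp: pverts_residue_graph)
          next
            case 3
            then have "i - 1 < p" "j - 1 < q" by auto
            from crt_ex[OF this] obtain k where "k < p * q" "k mod p = i - 1" "k mod q = j - 1" by blast
            then show ?thesis using 3 ne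
              by (intro image_eqI[of _ _ "(p * q, k)"]) (auto simp: pverts_residue_graph)
          qed
        qed
      qed
    qed
    show "pair_wf_digraph (triangles_graph p q)"
      unfolding pair_wf_digraph_def arcs by (auto simp: triangles_graph_def)
    fix u v
    assume "u \<in> pverts (residue_graph {p, q, p * q})" "v \<in> pverts (residue_graph {p, q, p * q})"
    then obtain d i e j where uv: "u = (d, i)" "v = (e, j)" "d \<in> {p, q, p * q}" "e \<in> {p, q, p * q}"
      "i < d" "j < e"
      by (auto simp: pverts_residue_graph)
    have g: "gcd p q = 1" "gcd q p = 1" "gcd p (p * q) = p" "gcd (p * q) p = p"
      "gcd q (p * q) = q" "gcd (p * q) q = q"
      using pq(3) by (simp_all add: coprime_iff_gcd_eq_1 gcd.commute)
    \<comment> \<open>All gcds that occur are odd, so the factor 2 disappears and adjacency becomes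
      congruence modulo the gcd.\<close>
    have dvd': "int (gcd d e) dvd 2 * (int i - int j) \<longleftrightarrow> i mod gcd d e = j mod gcd d e"
      using uv(3,4) g pq by (intro dvd) auto
    have "(u, v) \<in> parcs (residue_graph {p, q, p * q}) \<longleftrightarrow> u \<noteq> v \<and> i mod gcd d e = j mod gcd d e"
      using uv unfolding dvd'[symmetric] by (simp add: parcs_residue_graph)
    also have "\<dots> \<longleftrightarrow> (?f u, ?f v) \<in> parcs (triangles_graph p q)"
      using uv(3,4)
      by (elim insertE emptyE) (use uv(1,2,5,6) g ne pos in \<open>auto simp: edges Suc_le_eq\<close>)
    finally show "(?f u, ?f v) \<in> parcs (triangles_graph p q) \<longleftrightarrow>
        (u, v) \<in> parcs (residue_graph {p, q, p * q})" by simp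
  qed (rule pair_wf_residue_graph)
qed

section \<open>Normal forms in dihedral groups\<close>

text \<open>
  Words are evaluated in the infinite dihedral group \<open>\<langle>a, b | b\<^sup>2 = 1, ab = ba\<^sup>-\<^sup>1\<rangle>\<close>; reducing the exponent
  modulo \<open>n\<close> gives the invariant that separates the elements of \<open>dihedral n\<close>.
\<close>

definition dih_mult :: "int \<times> bool \<Rightarrow> int \<times> bool \<Rightarrow> int \<times> bool" where
  "dih_mult x y = (if snd x then fst x - fst y else fst x + fst y, snd x \<noteq> snd y)"

fun dih_letter :: "dihedral_gen \<times> bool \<Rightarrow> int \<times> bool" where
  "dih_letter (gen_a, s) = (if s then 1 else - 1, False)"
| "dih_letter (gen_b, s) = (0, True)"

fun dih_eval :: "dihedral_gen word \<Rightarrow> int \<times> bool" where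
  "dih_eval [] = (0, False)"
| "dih_eval (x # u) = dih_mult (dih_letter x) (dih_eval u)"

lemma dih_eval_append: "dih_eval (u @ v) = dih_mult (dih_eval u) (dih_eval v)"
  by (induction u) (auto simp: dih_mult_def)

lemma dih_eval_replicate: "dih_eval (replicate k (gen_a, True)) = (int k, False)"
  by (induction k) (auto simp: dih_mult_def)

definition dihedral_rels :: "nat \<Rightarrow> (dihedral_gen word \<times> dihedral_gen word) set" where
  "dihedral_rels n = {(replicate n (gen_a, True), []), (replicate 2 (gen_b, True), []),
     ([(gen_a, True), (gen_b, True)], [(gen_b, True), (gen_a, False)])}"

lemma dihedral_eq: "dihedral n = presented_group (dihedral_rels n)"
  by (simp add: dihedral_def dihedral_rels_def)

text \<open>This is the invariant that keeps normal forms apart. Evaluation respects cancellation,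
  b^2 = 1 and ab = ba^-1 exactly; only a^n = 1 changes the exponent, and it does so by n.\<close>

lemma dih_eval_cong:
  assumes "(u, v) \<in> word_cong (dihedral_rels n)"
  shows "snd (dih_eval u) = snd (dih_eval v) \<and> int n dvd fst (dih_eval u) - fst (dih_eval v)"
  using assms
proof (induction rule: word_cong.induct)
  case (rel u v)
  then show ?case
    by (auto simp: dihedral_rels_def dih_eval_replicate numeral_2_eq_2 dih_mult_def)
next
  case (cancel g s)
  show ?case by (cases g; cases s) (auto simp: dih_mult_def)
next
  case (app u v u' v')
  let ?f = "\<lambda>u. fst (dih_eval u)"
  \<comment> \<open>Both signs are needed: the exponent of the second factor is subtracted when the
    first factor is a reflection.\<close>
  have "int n dvd (?f u - ?f v) + (?f u' - ?f v')" "int n dvd (?f u - ?f v) - (?f u' - ?f v')"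
    using app.IH by (auto intro: dvd_add dvd_diff)
  then show ?case
    using app.IH by (auto simp: dih_eval_append dih_mult_def algebra_simps)
next
  case (sym u v)
  then show ?case by (metis dvd_diff_commute)
next
  case (trans u v w)
  then show ?case
    using dvd_add[of "int n" "fst (dih_eval u) - fst (dih_eval v)" "fst (dih_eval v) - fst (dih_eval w)"]
    by auto
qed auto

text \<open>\<open>el k s\<close> stands for \<open>a\<^sup>k b\<close> if \<open>s\<close> holds, and for \<open>a\<^sup>k\<close> otherwise.\<close>

locale dihedral_model = group G for G (structure) +
  fixes n :: nat and el :: "int \<Rightarrow> bool \<Rightarrow> 'a"
  assumes n_pos: "n > 0"
    and carrier_eq: "carrier G = range (case_prod el)"
    and el_eq_iff: "el k s = el l t \<longleftrightarrow> s = t \<and> int n dvd k - l"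
    and el_mult: "el k s \<otimes> el l t = el (if s then k - l else k + l) (s \<noteq> t)"

text \<open>The witness is \<open>el k s\<close> = A^k or A^k B in the presented group. Moving B
  past powers of A gives the multiplication rule, hence every word reduces to a normal form;
  conversely the evaluation of words shows that equal elements have equal type and congruent
  exponents.\<close>

lemma dihedral_model_dihedral:
  assumes "n > 0"
  shows "\<exists>el. dihedral_model (dihedral n) n el"
proof -
  let ?R = "dihedral_rels n"
  define G where "G = dihedral n"
  define cl where "cl u = word_cong ?R `` {u}" for u
  have mult: "cl u \<otimes>\<^bsub>G\<^esub> cl v = cl (u @ v)" for u v
    unfolding G_def dihedral_eq cl_def by (rule presented_group_mult_class)
  have one: "\<one>\<^bsub>G\<^esub> = cl []"
    by (simp add: G_def dihedral_eq cl_def presented_group_def)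
  have carrier: "carrier G = range cl"
    by (auto simp: G_def dihedral_eq cl_def[abs_def] presented_group_def quotient_def)
  have cl_eq: "cl u = cl v \<longleftrightarrow> (u, v) \<in> word_cong ?R" for u v
    unfolding cl_def using eq_equiv_class_iff[OF equiv_word_cong] by blast
  interpret group G
    unfolding G_def dihedral_eq by (rule group_presented_group)
  define A B where "A = cl [(gen_a, True)]" and "B = cl [(gen_b, True)]"
  have AB: "A \<in> carrier G" "B \<in> carrier G"
    by (auto simp: A_def B_def carrier)
  have cl_inv: "cl [(g, False)] = inv\<^bsub>G\<^esub> cl [(g, True)]" for g
    by (rule inv_equality[symmetric])
      (use word_cong.cancel[of g False ?R] in \<open>auto simp: mult one carrier cl_eq\<close>)
  have cl_A: "cl (replicate k (gen_a, True)) = A [^]\<^bsub>G\<^esub> k" for k :: nat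
  proof (induction k)
    case (Suc k)
    then show ?case
      using mult[of "replicate k (gen_a, True)" "[(gen_a, True)]"]
      by (simp add: A_def replicate_append_same)
  qed (simp add: one)
  have A_n: "A [^]\<^bsub>G\<^esub> n = \<one>\<^bsub>G\<^esub>"
    unfolding cl_A[symmetric] one cl_eq by (rule word_cong.rel) (simp add: dihedral_rels_def)
  have B_B: "B \<otimes>\<^bsub>G\<^esub> B = \<one>\<^bsub>G\<^esub>"
    unfolding B_def mult one cl_eq by (rule word_cong.rel) (simp add: dihedral_rels_def numeral_2_eq_2)
  have A_B: "A \<otimes>\<^bsub>G\<^esub> B = B \<otimes>\<^bsub>G\<^esub> inv\<^bsub>G\<^esub> A"
    unfolding A_def B_def cl_inv[symmetric] mult cl_eq
    by (rule word_cong.rel) (simp add: dihedral_rels_def)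
  have inv_B: "inv\<^bsub>G\<^esub> B = B"
    using B_B AB inv_equality by blast
  define el where "el k s = A [^]\<^bsub>G\<^esub> k \<otimes>\<^bsub>G\<^esub> (if s then B else \<one>\<^bsub>G\<^esub>)" for k :: int and s
  have el_carrier: "el k s \<in> carrier G" for k s
    using AB by (simp add: el_def)
  have B_A: "B \<otimes>\<^bsub>G\<^esub> A [^]\<^bsub>G\<^esub> k = A [^]\<^bsub>G\<^esub> (- k) \<otimes>\<^bsub>G\<^esub> B" for k :: int
  proof -
    have nat: "A [^]\<^bsub>G\<^esub> j \<otimes>\<^bsub>G\<^esub> B = B \<otimes>\<^bsub>G\<^esub> inv\<^bsub>G\<^esub> (A [^]\<^bsub>G\<^esub> j)" for j :: nat
    proof (induction j)
      case (Suc j)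
      have "A [^]\<^bsub>G\<^esub> Suc j \<otimes>\<^bsub>G\<^esub> B = A [^]\<^bsub>G\<^esub> j \<otimes>\<^bsub>G\<^esub> B \<otimes>\<^bsub>G\<^esub> inv\<^bsub>G\<^esub> A"
        using AB A_B by (simp add: m_assoc)
      also have "\<dots> = B \<otimes>\<^bsub>G\<^esub> (inv\<^bsub>G\<^esub> (A [^]\<^bsub>G\<^esub> j) \<otimes>\<^bsub>G\<^esub> inv\<^bsub>G\<^esub> A)"
        using AB by (simp add: Suc.IH m_assoc)
      also have "\<dots> = B \<otimes>\<^bsub>G\<^esub> inv\<^bsub>G\<^esub> (A \<otimes>\<^bsub>G\<^esub> A [^]\<^bsub>G\<^esub> j)"
        using AB by (simp add: inv_mult_group)
      also have "A \<otimes>\<^bsub>G\<^esub> A [^]\<^bsub>G\<^esub> j = A [^]\<^bsub>G\<^esub> Suc j"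
        using AB by (metis nat_pow_Suc2)
      finally show ?case .
    qed (use AB in simp)
    \<comment> \<open>Read from right to left, this is the claim for the exponent
      \<open>- int j\<close>; multiplying by the inverse of A^j on the left and by A^j on the right
      gives it for \<open>int j\<close>.\<close>
    have pos: "A [^]\<^bsub>G\<^esub> int j \<otimes>\<^bsub>G\<^esub> B = B \<otimes>\<^bsub>G\<^esub> A [^]\<^bsub>G\<^esub> (- int j)" for j
      using nat[of j] AB by (simp add: int_pow_neg int_pow_int)
    have "B \<otimes>\<^bsub>G\<^esub> A [^]\<^bsub>G\<^esub> int j = A [^]\<^bsub>G\<^esub> (- int j) \<otimes>\<^bsub>G\<^esub> B" for j
    proof -
      let ?a = "A [^]\<^bsub>G\<^esub> int j"
      have a: "?a \<in> carrier G" using AB by simp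
      have "inv\<^bsub>G\<^esub> ?a \<otimes>\<^bsub>G\<^esub> (?a \<otimes>\<^bsub>G\<^esub> B) \<otimes>\<^bsub>G\<^esub> ?a = inv\<^bsub>G\<^esub> ?a \<otimes>\<^bsub>G\<^esub> (B \<otimes>\<^bsub>G\<^esub> inv\<^bsub>G\<^esub> ?a) \<otimes>\<^bsub>G\<^esub> ?a"
        using pos[of j] AB by (simp add: int_pow_neg)
      moreover have "inv\<^bsub>G\<^esub> ?a \<otimes>\<^bsub>G\<^esub> (?a \<otimes>\<^bsub>G\<^esub> B) \<otimes>\<^bsub>G\<^esub> ?a = B \<otimes>\<^bsub>G\<^esub> ?a"
        using a AB(2) by (simp add: m_assoc[symmetric])
      moreover have "inv\<^bsub>G\<^esub> ?a \<otimes>\<^bsub>G\<^esub> (B \<otimes>\<^bsub>G\<^esub> inv\<^bsub>G\<^esub> ?a) \<otimes>\<^bsub>G\<^esub> ?a = inv\<^bsub>G\<^esub> ?a \<otimes>\<^bsub>G\<^esub> B"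
        using a AB(2) by (simp add: m_assoc)
      ultimately show ?thesis
        using AB by (simp add: int_pow_neg)
    qed
    then show ?thesis
      using pos by (cases k rule: int_cases2) auto
  qed
  have el_mult: "el k s \<otimes>\<^bsub>G\<^esub> el l t = el (if s then k - l else k + l) (s \<noteq> t)" for k s l t
  proof (cases s)
    case False
    then show ?thesis using AB
      by (simp add: el_def int_pow_mult m_assoc)
  next
    case True
    have "el k s \<otimes>\<^bsub>G\<^esub> el l t
        = A [^]\<^bsub>G\<^esub> k \<otimes>\<^bsub>G\<^esub> (B \<otimes>\<^bsub>G\<^esub> A [^]\<^bsub>G\<^esub> l) \<otimes>\<^bsub>G\<^esub> (if t then B else \<one>\<^bsub>G\<^esub>)"
      using AB True by (simp add: el_def m_assoc)
    also have "\<dots> = A [^]\<^bsub>G\<^esub> (k - l) \<otimes>\<^bsub>G\<^esub> (B \<otimes>\<^bsub>G\<^esub> (if t then B else \<one>\<^bsub>G\<^esub>))"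
      using AB int_pow_mult[of A k "- l"] by (simp add: B_A m_assoc[symmetric])
    finally show ?thesis using AB True B_B by (simp add: el_def)
  qed
  \<comment> \<open>Every word represents the normal form obtained by evaluating it, so the elements
    \<open>el k s\<close> exhaust the group.\<close>
  have cl_el: "cl u = case_prod el (dih_eval u)" for u
  proof (induction u)
    case Nil
    show ?case using AB by (simp add: el_def flip: one)
  next
    case (Cons x u)
    have "cl [x] = case_prod el (dih_letter x)"
    proof (cases x rule: dih_letter.cases)
      case (1 s)
      then show ?thesis using AB cl_inv[of gen_a] by (cases s) (simp_all add: el_def int_pow_neg flip: A_def)
    next
      case (2 s)
      then show ?thesis using AB inv_B cl_inv[of gen_b] by (cases s) (simp_all add: el_def flip: B_def)
    qed
    then have "cl (x # u) = case_prod el (dih_letter x) \<otimes>\<^bsub>G\<^esub> case_prod el (dih_eval u)"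
      using Cons.IH mult[of "[x]" u] by simp
    then show ?case
      by (simp add: el_mult dih_mult_def split_beta)
  qed
  \<comment> \<open>A representing word with reduced exponent is chosen, so that congruent exponents
    lead to words with the same evaluation.\<close>
  have el_cl: "\<exists>u. dih_eval u = (k mod int n, s) \<and> cl u = el k s" for k s
  proof -
    let ?u = "replicate (nat (k mod int n)) (gen_a, True) @ (if s then [(gen_b, True)] else [])"
    have ev: "dih_eval ?u = (k mod int n, s)"
      using assms by (auto simp: dih_eval_append dih_eval_replicate dih_mult_def)
    have "A [^]\<^bsub>G\<^esub> k = A [^]\<^bsub>G\<^esub> (int n * (k div int n) + k mod int n)"
      by simp
    also have "\<dots> = A [^]\<^bsub>G\<^esub> (k mod int n)"
      using AB A_n unfolding int_pow_mult[OF AB(1)] int_pow_pow[OF AB(1), symmetric] by (simp add: int_pow_int)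
    finally have "el (k mod int n) s = el k s"
      by (simp add: el_def)
    then show ?thesis using ev cl_el[of ?u] by (intro exI[of _ ?u]) simp
  qed
  have "el k s = el l t \<longleftrightarrow> s = t \<and> int n dvd k - l" for k s l t
  proof -
    obtain u v where u: "dih_eval u = (k mod int n, s)" "cl u = el k s"
      and v: "dih_eval v = (l mod int n, t)" "cl v = el l t"
      using el_cl by meson
    show ?thesis
    proof
      assume "el k s = el l t"
      then have "(u, v) \<in> word_cong ?R" using u v cl_eq by metis
      from dih_eval_cong[OF this] show "s = t \<and> int n dvd k - l"
        using u v by (simp add: mod_eq_dvd_iff[symmetric])
    next
      assume "s = t \<and> int n dvd k - l"
      then have "dih_eval u = dih_eval v" using u v by (simp add: mod_eq_dvd_iff)
      then have "cl u = cl v" by (simp add: cl_el)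
      then show "el k s = el l t" using u v by simp
    qed
  qed
  moreover have "carrier G = range (case_prod el)"
    unfolding carrier using cl_el el_carrier carrier by fastforce
  ultimately have "dihedral_model G n el"
    using assms el_mult by unfold_locales
  then show ?thesis unfolding G_def by blast
qed

section \<open>Subgroups of dihedral groups\<close>

text \<open>Closure under subtraction makes \<open>R\<close> a nonzero subgroup of the integers; its
  generator is the least positive element, by division with remainder.\<close>

lemma int_subgroup_multiples:
  fixes R :: "int set"
  assumes m: "m \<in> R" "m \<noteq> 0" and diff: "\<And>k l. k \<in> R \<Longrightarrow> l \<in> R \<Longrightarrow> k - l \<in> R"
  obtains d :: nat where "d > 0" "\<And>k. k \<in> R \<longleftrightarrow> int d dvd k"
proof -
  have zero: "0 \<in> R" using diff[OF m(1) m(1)] by simp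
  have neg: "- k \<in> R" if "k \<in> R" for k using diff[OF zero that] by simp
  have add: "k + l \<in> R" if "k \<in> R" "l \<in> R" for k l
    using diff[OF that(1) neg[OF that(2)]] by simp
  define d where "d = (LEAST j. j > 0 \<and> int j \<in> R)"
  have ex: "nat \<bar>m\<bar> > 0 \<and> int (nat \<bar>m\<bar>) \<in> R"
    using m neg[of m] by (auto simp: abs_if)
  have d: "d > 0" "int d \<in> R" and least: "\<And>j. j > 0 \<Longrightarrow> int j \<in> R \<Longrightarrow> d \<le> j"
    using LeastI[of "\<lambda>j. j > 0 \<and> int j \<in> R", OF ex] Least_le[of "\<lambda>j. j > 0 \<and> int j \<in> R"]
    unfolding d_def by auto
  have mult_nat: "int d * int j \<in> R" for j
    by (induction j) (auto simp: zero algebra_simps intro: add d)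
  have mult: "int d * x \<in> R" for x
    using mult_nat neg by (cases x rule: int_cases2) auto
  have "int d dvd k" if "k \<in> R" for k
  proof -
    have "k - int d * (k div int d) \<in> R" using diff[OF that mult] .
    then have "k mod int d \<in> R" by (simp add: minus_mult_div_eq_mod)
    moreover have "k mod int d < int d" "0 \<le> k mod int d" using d by auto
    ultimately have "k mod int d = 0" using least[of "nat (k mod int d)"] by fastforce
    then show ?thesis by auto
  qed
  then show ?thesis using that[of d] d mult by (auto elim!: dvdE)
qed

text \<open>Bezout's identity for the sum of the subgroups generated by a and b; it is the source of
  the gcd in products of subgroups.\<close>

lemma gcd_dvd_iff_bezout: "gcd a b dvd k \<longleftrightarrow> (\<exists>x y. a dvd x \<and> b dvd y \<and> k = x + y)"
  for a b k :: int
proof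
  assume "gcd a b dvd k"
  then obtain c where "k = gcd a b * c" ..
  moreover obtain u v where "gcd a b = u * a + v * b" by (metis bezout_int)
  ultimately have "k = a * (u * c) + b * (v * c)" by (simp add: algebra_simps)
  then show "\<exists>x y. a dvd x \<and> b dvd y \<and> k = x + y" by (intro exI[of _ "a * (u * c)"] exI[of _ "b * (v * c)"]) simp
qed (auto intro: dvd_add dvd_trans[OF gcd_dvd1] dvd_trans[OF gcd_dvd2])

section \<open>The subgroups H(d, i) and their products\<close>

context dihedral_model
begin

lemma el_closed [simp]: "el k s \<in> carrier G"
  by (auto simp: carrier_eq)

lemma el_cases:
  assumes "x \<in> carrier G"
  obtains k s where "x = el k s"
  using assms by (auto simp: carrier_eq)

lemma one_el: "\<one> = el 0 False"
proof -
  have "el 0 False \<otimes> el 0 False = el 0 False" by (simp add: el_mult)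
  then show ?thesis by (metis el_closed l_cancel_one)
qed

lemma inv_el: "inv (el k s) = el (if s then k else - k) s"
  by (rule inv_equality) (auto simp: el_mult one_el)

text \<open>This is H(d, i), listed by normal forms. The exponents run over all integers, and those
  congruent modulo \<open>n\<close> give the same element.\<close>

definition sub :: "nat \<Rightarrow> nat \<Rightarrow> 'a set" where
  "sub d i = {el k False | k. int d dvd k} \<union> {el k True | k. int d dvd k - int i}"

text \<open>An element fixes its exponent only modulo \<open>n\<close>; as d divides
  \<open>n\<close>, the condition modulo d does not depend on the chosen exponent.\<close>

lemma el_in_sub:
  assumes "d dvd n"
  shows "el k s \<in> sub d i \<longleftrightarrow> int d dvd (if s then k - int i else k)"
proof -
  have *: "int d dvd k - j \<longleftrightarrow> int d dvd l - j" if "int n dvd k - l" for k l j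
  proof -
    have "int d dvd (k - j) - (l - j)" using that assms by (auto intro: dvd_trans[of _ "int n"])
    then show ?thesis by (metis dvd_diff_right_iff dvd_diff_left_iff)
  qed
  show ?thesis
    using *[of k _ "int i"] *[of k _ 0] by (cases s) (auto simp: sub_def el_eq_iff intro!: exI[of _ k])
qed

lemma sub_subset: "sub d i \<subseteq> carrier G"
  by (auto simp: sub_def)

lemma subgroup_sub:
  assumes "d dvd n"
  shows "subgroup (sub d i) G"
proof (rule subgroupI[OF sub_subset])
  show "sub d i \<noteq> {}" by (auto simp: sub_def)
  fix x y assume x: "x \<in> sub d i" and y: "y \<in> sub d i"
  obtain k s l t where xy: "x = el k s" "y = el l t"
    using x y sub_subset by (meson el_cases subsetD)
  show "inv x \<in> sub d i"
    using x assms by (auto simp: xy inv_el el_in_sub)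
  have kl: "int d dvd (if s then k - int i else k)" "int d dvd (if t then l - int i else l)"
    using x y assms by (simp_all add: xy el_in_sub)
  \<comment> \<open>The exponent of the product, reduced by \<open>i\<close> if the product is a
    reflection, is the sum when \<open>x\<close> is a rotation and the difference when
    \<open>x\<close> is a reflection.\<close>
  have "int d dvd (if s then k - int i else k) + (if t then l - int i else l)"
    "int d dvd (if s then k - int i else k) - (if t then l - int i else l)"
    using kl by (rule dvd_add, intro dvd_diff kl)
  then show "x \<otimes> y \<in> sub d i"
    using assms by (auto simp: xy el_mult el_in_sub algebra_simps)
qed

text \<open>Conjugating a^i b by a gives a^(i+2) b, so normality would force d to divide 2.\<close>

lemma sub_not_normal:
  assumes "d dvd n" "d \<ge> 3"
  shows "\<not> sub d i \<lhd> G"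
proof
  assume "sub d i \<lhd> G"
  then have "el 1 False \<otimes> el (int i) True \<otimes> inv (el 1 False) \<in> sub d i"
    by (rule normal.inv_op_closed2) (use assms in \<open>auto simp: el_in_sub\<close>)
  then have "int d dvd 2"
    using assms by (simp add: inv_el el_mult el_in_sub)
  then show False using assms zdvd_imp_le[of "int d" 2] by simp
qed

lemma sub_normal:
  assumes "d dvd n" "d dvd 2"
  shows "sub d i \<lhd> G"
proof (rule normal_invI[OF subgroup_sub[OF assms(1)]])
  fix x h assume x: "x \<in> carrier G" and h: "h \<in> sub d i"
  obtain l t where x: "x = el l t" using x by (rule el_cases)
  obtain k s where hk: "h = el k s" using h sub_subset by (meson el_cases subsetD)
  have k: "int d dvd (if s then k - int i else k)"
    using h assms by (simp add: hk el_in_sub)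
  have "int d dvd 2" using assms(2) by presburger
  then have 2: "int d dvd 2 * y" for y by simp
  \<comment> \<open>The conjugates of a^k b are a^(2l-k) b by a reflection and a^(2l+k) b by a
    rotation; as d divides 2, both stay in the class of \<open>i\<close>.\<close>
  have "int d dvd 2 * l - int i - k" "int d dvd 2 * l + (k - int i)" if s
    using k that dvd_add[OF 2[of "l - k"], of "k - int i"] dvd_add[OF 2[of l], of "k - int i"]
    by (simp_all add: algebra_simps)
  then show "x \<otimes> h \<otimes> inv x \<in> sub d i"
    using k assms by (auto simp: x hk el_mult inv_el el_in_sub algebra_simps)
qed

text \<open>Here d generates the exponents of rotations in \<open>H\<close>, and i is the exponent
  modulo d of any reflection in \<open>H\<close>. Non-normality supplies the reflection and excludes
  d = 1 and d = 2.\<close>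

lemma nonnormal_subgroup_eq_sub:
  assumes H: "subgroup H G" and nn: "\<not> H \<lhd> G"
  obtains d i where "d dvd n" "d \<ge> 3" "i < d" "H = sub d i"
proof -
  interpret H: subgroup H G by fact
  have mem: "el k False \<otimes> inv (el l False) = el (k - l) False" for k l
    by (simp add: el_mult inv_el)
  have n: "int n \<in> {k. el k False \<in> H}"
    using H.one_closed el_eq_iff[of 0 False "int n" False] by (simp add: one_el)
  obtain d where d: "d > 0" "\<And>k. k \<in> {k. el k False \<in> H} \<longleftrightarrow> int d dvd k"
  proof (rule int_subgroup_multiples[OF n])
    show "int n \<noteq> 0" using n_pos by simp
    show "k - l \<in> {k. el k False \<in> H}"
      if "k \<in> {k. el k False \<in> H}" "l \<in> {k. el k False \<in> H}" for k l
      using H.m_closed[OF _ H.m_inv_closed, of "el k False" "el l False"] that by (simp add: mem)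
  qed blast
  have rot: "el k False \<in> H \<longleftrightarrow> int d dvd k" for k using d(2) by simp
  have dn: "d dvd n" using n rot by simp
  have "\<exists>j. el j True \<in> H"
  proof (rule ccontr)
    \<comment> \<open>A subgroup of rotations is normal, since conjugation sends a^k to a^k or
      a^-k.\<close>
    assume no: "\<nexists>j. el j True \<in> H"
    have "H \<lhd> G"
    proof (rule normal_invI[OF H])
      fix x h assume x: "x \<in> carrier G" and h: "h \<in> H"
      obtain l t where x: "x = el l t" using x by (rule el_cases)
      obtain k s where hk: "h = el k s" using h H.subset by (meson el_cases subsetD)
      have "\<not> s" using no h hk by (cases s) auto
      then show "x \<otimes> h \<otimes> inv x \<in> H"
        using h rot by (auto simp: x hk el_mult inv_el)
    qed
    with nn show False by blast
  qed
  then obtain j where j: "el j True \<in> H" ..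
  define i where "i = nat (j mod int d)"
  have i: "i < d" "int d dvd j - int i"
    using d(1) by (auto simp: i_def nat_less_iff minus_mod_eq_mult_div)
  have refl: "el k True \<in> H \<longleftrightarrow> int d dvd k - int i" for k
  proof -
    \<comment> \<open>Multiplication by the fixed reflection in \<open>H\<close> turns reflections
      into rotations, whose exponents are known.\<close>
    have "el k True \<in> H \<longleftrightarrow> el k True \<otimes> el j True \<in> H"
    proof
      assume "el k True \<otimes> el j True \<in> H"
      then have "el k True \<otimes> el j True \<otimes> el j True \<in> H" using j by blast
      then show "el k True \<in> H" by (simp add: el_mult)
    qed (use j in blast)
    also have "\<dots> \<longleftrightarrow> int d dvd k - j" by (simp add: el_mult rot)
    also have "\<dots> \<longleftrightarrow> int d dvd k - int i"
      using i(2) dvd_add_left_iff[of "int d" "j - int i" "k - j"] by simp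
    finally show ?thesis .
  qed
  have "x \<in> H \<longleftrightarrow> x \<in> sub d i" if x: "x \<in> carrier G" for x
  proof -
    obtain k s where "x = el k s" using el_cases[OF x] .
    then show ?thesis
      using el_in_sub[OF dn, of k s i] rot[of k] refl[of k] by (cases s) simp_all
  qed
  then have eq: "H = sub d i"
    using H.subset sub_subset by (intro subset_antisym subsetI) (meson subsetD)+
  have "d \<ge> 3"
  proof (rule ccontr)
    assume "\<not> d \<ge> 3"
    then have "d = 1 \<or> d = 2" using d(1) by auto
    then have "d dvd 2" by auto
    then show False using nn sub_normal[OF dn] eq by simp
  qed
  then show ?thesis using that dn i eq by blast
qed

text \<open>The rotations in the subgroup determine d, and then the reflections determine i modulo
  d.\<close>

lemma sub_eq_iff:
  assumes "d dvd n" "e dvd n" "i < d" "j < e"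
  shows "sub d i = sub e j \<longleftrightarrow> d = e \<and> i = j"
proof
  assume eq: "sub d i = sub e j"
  have "int d dvd k \<longleftrightarrow> int e dvd k" for k
    using eq el_in_sub[of d k False i] el_in_sub[of e k False j] assms by simp
  from this[of "int d"] this[of "int e"] have de: "d = e" by (simp add: dvd_antisym)
  have "int e dvd int i - int j"
    using eq el_in_sub[of d "int i" True i] el_in_sub[of e "int i" True j] assms by simp
  then have "int i mod int e = int j mod int e" by (simp add: mod_eq_dvd_iff)
  then show "d = e \<and> i = j" using de assms by simp
qed simp

text \<open>The two alternatives for each type correspond to a left factor that is a rotation or a
  reflection: the exponents are then added or subtracted, and sums or differences of classes modulo
  d and e fill a class modulo the gcd.\<close>

lemma el_in_sub_mult:
  assumes "d dvd n" "e dvd n"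
  shows "el k s \<in> sub d i <#> sub e j \<longleftrightarrow>
    (if s then int (gcd d e) dvd k - int i \<or> int (gcd d e) dvd k - int j
     else int (gcd d e) dvd k \<or> int (gcd d e) dvd k - (int i - int j))"
proof -
  have mult: "el k s \<in> sub d i <#> sub e j \<longleftrightarrow>
    (\<exists>x t y. el x t \<in> sub d i \<and> el y (s \<noteq> t) \<in> sub e j \<and> k = (if t then x - y else x + y))"
    (is "?L \<longleftrightarrow> ?R")
  proof
    assume ?L
    then obtain g h where gh: "g \<in> sub d i" "h \<in> sub e j" "el k s = g \<otimes> h"
      by (auto simp: set_mult_def)
    obtain x t where g: "g = el x t" using gh(1) sub_subset by (meson el_cases subsetD)
    \<comment> \<open>Computing \<open>h\<close> from \<open>g\<close> selects an exponent for which
      the equation for \<open>k\<close> holds in the integers and not only modulo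
      \<open>n\<close>.\<close>
    have "h = inv g \<otimes> el k s"
      using gh sub_subset by (metis el_closed inv_solve_left subsetD)
    then have "h = el (if t then x - k else k - x) (s \<noteq> t)"
      by (auto simp: g inv_el el_mult)
    then show ?R using gh g
      by (intro exI[of _ x] exI[of _ t] exI[of _ "if t then x - k else k - x"]) auto
  next
    assume ?R
    then obtain x t y where r: "el x t \<in> sub d i" "el y (s \<noteq> t) \<in> sub e j"
      "k = (if t then x - y else x + y)" by blast
    then have "el k s = el x t \<otimes> el y (s \<noteq> t)" by (auto simp: el_mult)
    then show ?L using r unfolding set_mult_def by blast
  qed
  have bez: "int (gcd d e) dvd k \<longleftrightarrow> (\<exists>x y. int d dvd x \<and> int e dvd y \<and> k = x + y)" for k
    using gcd_dvd_iff_bezout[of "int d" "int e" k] by simp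
  have shift: "(\<exists>x y. int d dvd x - a \<and> int e dvd y - b \<and> k = x + y) \<longleftrightarrow> int (gcd d e) dvd k - (a + b)"
    for a b k
    unfolding bez
  proof safe
    fix x y assume "int d dvd x - a" "int e dvd y - b"
    then show "\<exists>x' y'. int d dvd x' \<and> int e dvd y' \<and> x + y - (a + b) = x' + y'"
      by (intro exI[of _ "x - a"] exI[of _ "y - b"]) auto
  next
    fix x y assume "int d dvd x" "int e dvd y" "k - (a + b) = x + y"
    then show "\<exists>x y. int d dvd x - a \<and> int e dvd y - b \<and> k = x + y"
      by (intro exI[of _ "x + a"] exI[of _ "y + b"]) auto
  qed
  \<comment> \<open>Differences reduce to sums by replacing y and b with their negatives.\<close>
  have shift': "(\<exists>x y. int d dvd x - a \<and> int e dvd y - b \<and> k = x - y) \<longleftrightarrow> int (gcd d e) dvd k - (a - b)"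
    for a b k
  proof -
    have "(\<exists>x y. int d dvd x - a \<and> int e dvd y - b \<and> k = x - y) \<longleftrightarrow>
        (\<exists>x y. int d dvd x - a \<and> int e dvd y - (- b) \<and> k = x + y)"
    proof safe
      fix x y assume "int d dvd x - a" "int e dvd y - b"
      then show "\<exists>x' y'. int d dvd x' - a \<and> int e dvd y' - (- b) \<and> x - y = x' + y'"
        by (intro exI[of _ x] exI[of _ "- y"]) (auto simp: dvd_diff_commute)
    next
      fix x y assume "int d dvd x - a" "int e dvd y - (- b)"
      then have "int e dvd - (y - (- b))" by (simp only: dvd_minus_iff)
      then show "\<exists>x' y'. int d dvd x' - a \<and> int e dvd y' - b \<and> x + y = x' - y'"
        using \<open>int d dvd x - a\<close> by (intro exI[of _ x] exI[of _ "- y"]) auto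
    qed
    then show ?thesis using shift[of a "- b" k] by simp
  qed
  show ?thesis
  proof (cases s)
    case True
    then show ?thesis
      using shift[of 0 "int j" k] shift'[of "int i" 0 k] assms
      unfolding mult by (auto simp: el_in_sub ex_bool_eq)
  next
    case False
    then show ?thesis
      using shift[of 0 0 k] shift'[of "int i" "int j" k] assms
      unfolding mult by (auto simp: el_in_sub ex_bool_eq)
  qed
qed

lemma sub_permute_iff:
  assumes "d dvd n" "e dvd n"
  shows "sub d i <#> sub e j = sub e j <#> sub d i \<longleftrightarrow> int (gcd d e) dvd 2 * (int i - int j)"
proof -
  let ?g = "int (gcd d e)" and ?y = "int i - int j"
  have sub: "sub d i <#> sub e j \<subseteq> carrier G" "sub e j <#> sub d i \<subseteq> carrier G"
    using set_mult_closed sub_subset by blast+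
  have "sub d i <#> sub e j = sub e j <#> sub d i \<longleftrightarrow>
      (\<forall>k s. el k s \<in> sub d i <#> sub e j \<longleftrightarrow> el k s \<in> sub e j <#> sub d i)"
    using sub by (blast elim: el_cases)
  \<comment> \<open>Exchanging the factors only swaps the two alternatives for reflections, so just
    the condition on rotations remains, where the offset changes sign.\<close>
  also have "\<dots> \<longleftrightarrow> (\<forall>k. ?g dvd k \<or> ?g dvd k - ?y \<longleftrightarrow> ?g dvd k \<or> ?g dvd k + ?y)"
  proof -
    have "k - (int j - int i) = k + ?y" for k by simp
    then show ?thesis
      unfolding el_in_sub_mult[OF assms] el_in_sub_mult[OF assms(2,1)] gcd.commute[of e d]
        all_bool_eq by (simp only: if_True if_False disj_commute simp_thms)
  qed
  also have "\<dots> \<longleftrightarrow> ?g dvd 2 * ?y"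
  proof
    assume "\<forall>k. ?g dvd k \<or> ?g dvd k - ?y \<longleftrightarrow> ?g dvd k \<or> ?g dvd k + ?y"
    \<comment> \<open>At k = \<open>?y\<close> the left side holds, so \<open>?g\<close> divides
      \<open>?y\<close> or 2 * \<open>?y\<close>.\<close>
    from this[rule_format, of ?y] show "?g dvd 2 * ?y"
      by (metis diff_self dvd_0_right dvd_mult mult_2)
  next
    assume "?g dvd 2 * ?y"
    \<comment> \<open>Conversely, the offsets \<open>?y\<close> and its negative are congruent
      modulo \<open>?g\<close>.\<close>
    then have "?g dvd k - ?y \<longleftrightarrow> ?g dvd k + ?y" for k
      using dvd_add_left_iff[of ?g "2 * ?y" "k - ?y"] by (simp add: algebra_simps)
    then show "\<forall>k. ?g dvd k \<or> ?g dvd k - ?y \<longleftrightarrow> ?g dvd k \<or> ?g dvd k + ?y" by blast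
  qed
  finally show ?thesis .
qed

lemma residue_graph_iso: "residue_graph {d. d dvd n \<and> 3 \<le> d} \<simeq> nonnormal_permutability_graph G"
proof (rule graph_isoI[OF pair_wf_residue_graph pair_wf_nonnormal_permutability_graph])
  let ?D = "{d. d dvd n \<and> 3 \<le> d}" and ?N = "nonnormal_permutability_graph G"
  have proper: "sub d i \<noteq> carrier G" if "d dvd n" "3 \<le> d" for d i
  proof
    assume "sub d i = carrier G"
    \<comment> \<open>The generator a itself would have to lie in the subgroup.\<close>
    then have "int d dvd 1" using el_in_sub[OF that(1), of 1 False i] by simp
    then show False using that(2) by simp
  qed
  have verts: "sub d i \<in> pverts ?N" if "d dvd n" "3 \<le> d" for d i
    using that subgroup_sub proper sub_not_normal
    by (auto simp: nonnormal_permutability_graph_def Let_def)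
  show "bij_betw (case_prod sub) (pverts (residue_graph ?D)) (pverts ?N)"
  proof (rule bij_betw_imageI)
    show "inj_on (case_prod sub) (pverts (residue_graph ?D))"
      by (auto simp: inj_on_def pverts_residue_graph sub_eq_iff)
    show "case_prod sub ` pverts (residue_graph ?D) = pverts ?N"
    proof
      show "case_prod sub ` pverts (residue_graph ?D) \<subseteq> pverts ?N"
        using verts by (auto simp: pverts_residue_graph)
      show "pverts ?N \<subseteq> case_prod sub ` pverts (residue_graph ?D)"
      proof
        fix H assume "H \<in> pverts ?N"
        then have "subgroup H G" "\<not> H \<lhd> G"
          by (auto simp: nonnormal_permutability_graph_def Let_def)
        then obtain d i where "d dvd n" "d \<ge> 3" "i < d" "H = sub d i"
          by (rule nonnormal_subgroup_eq_sub)
        then show "H \<in> case_prod sub ` pverts (residue_graph ?D)"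
          by (force simp: pverts_residue_graph)
      qed
    qed
  qed
  fix u v assume "u \<in> pverts (residue_graph ?D)" "v \<in> pverts (residue_graph ?D)"
  then obtain d i e j where uv: "u = (d, i)" "v = (e, j)" "d dvd n" "3 \<le> d" "e dvd n" "3 \<le> e"
    "i < d" "j < e"
    by (auto simp: pverts_residue_graph)
  have "(sub d i, sub e j) \<in> parcs ?N \<longleftrightarrow>
      sub d i \<noteq> sub e j \<and> sub d i <#> sub e j = sub e j <#> sub d i"
    using verts uv by (auto simp: nonnormal_permutability_graph_def Let_def)
  then show "(case_prod sub u, case_prod sub v) \<in> parcs ?N \<longleftrightarrow> (u, v) \<in> parcs (residue_graph ?D)"
    using uv by (simp add: sub_eq_iff sub_permute_iff parcs_residue_graph)
qed

end

lemma nonnormal_permutability_graph_dihedral: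
  assumes "n > 0"
  shows "nonnormal_permutability_graph (dihedral n) \<simeq> residue_graph {d. d dvd n \<and> 3 \<le> d}"
  using dihedral_model_dihedral[OF assms] dihedral_model.residue_graph_iso graph_iso_sym by blast

section \<open>Factorizations of the index\<close>

text \<open>The assumptions make k the largest power of p below 3. Dividing a power of p that is at
  least 3 by p therefore leaves either k or again a power that is at least 3.\<close>

lemma prime_power_divisors_scale:
  fixes p :: nat
  assumes "prime p" "\<alpha> > 0" "k = p ^ \<beta>" "\<beta> < \<alpha>" "k < 3" "3 \<le> p * k"
  shows "{d. d dvd p ^ \<alpha> \<and> 3 \<le> d} = (*) p ` insert k {d. d dvd p ^ (\<alpha> - 1) \<and> 3 \<le> d}" (is "?L = ?R")
proof
  have p: "p > 1" using assms(1) by (rule prime_gt_1_nat)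
  have less: "p ^ i < p ^ j \<longleftrightarrow> i < j" for i j using p by simp
  show "?L \<subseteq> ?R"
  proof
    fix d assume "d \<in> ?L"
    then obtain i where d: "d = p ^ i" "i \<le> \<alpha>" "3 \<le> d"
      using assms(1) by (auto simp: divides_primepow_nat)
    have i: "\<beta> < i"
    proof -
      have "p ^ \<beta> < p ^ i" using d assms by simp
      then show ?thesis by (simp add: less)
    qed
    then obtain j where j: "i = Suc j" by (cases i) auto
    have "p ^ j = k \<or> 3 \<le> p ^ j"
    proof (cases "j = \<beta>")
      case False
      then have "Suc \<beta> \<le> j" using i j by simp
      then have "p ^ Suc \<beta> \<le> p ^ j" using p by (intro power_increasing) auto
      then show ?thesis using assms by simp
    qed (use assms in simp)
    moreover have "p ^ j dvd p ^ (\<alpha> - 1)" using d j by (intro le_imp_power_dvd) auto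
    ultimately show "d \<in> ?R" using d j by auto
  qed
  have "p * d dvd p ^ \<alpha>" if "d dvd p ^ (\<alpha> - 1)" for d
    using that assms(2) by (metis Suc_diff_1 mult_dvd_mono dvd_refl power_Suc)
  moreover have "k dvd p ^ (\<alpha> - 1)" using assms by (auto intro: le_imp_power_dvd)
  moreover have "3 \<le> p * d" if "3 \<le> d" for d using that p by (metis le_trans mult_le_mono1 mult_1 less_imp_le)
  ultimately show "?R \<subseteq> ?L" using assms(6) by auto
qed

text \<open>One argument serves p = 2 with k = 2 and odd p with k = 1: scaling strips one factor p
  from all moduli, which leaves the moduli for p^(\<alpha>-1) together with k, and k accounts for
  the joined complete graph.\<close>

lemma nonnormal_permutability_graph_dihedral_prime_power:
  fixes p :: nat
  assumes p: "prime p" and "\<beta> < \<alpha>" and k: "k = p ^ \<beta>" "k = 1 \<and> odd p \<or> k = 2"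
  shows "nonnormal_permutability_graph (dihedral (p ^ \<alpha>)) \<simeq>
    graph_copies p (graph_join (nonnormal_permutability_graph (dihedral (p ^ (\<alpha> - 1)))) (complete_graph k))"
proof -
  let ?D = "{d. d dvd p ^ (\<alpha> - 1) \<and> 3 \<le> d}"
  have p0: "p > 0" using p by (rule prime_gt_0_nat)
  have k2: "p = 2" if "k = 2"
  proof -
    have "p dvd 2" using that k(1) by (cases \<beta>) (auto intro: dvdI)
    then show ?thesis using p two_is_prime_nat primes_dvd_imp_eq by blast
  qed
  have k3: "k < 3" "3 \<le> p * k"
    using k(2) k2 prime_ge_2_nat[OF p] by (auto simp: le_less Suc_le_eq numeral_3_eq_3 numeral_2_eq_2)
  \<comment> \<open>For p = 2 the remaining moduli are 2 and powers of 2 that are at least 3, hence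
    even as the scaling requires.\<close>
  have even: "odd p \<or> (\<forall>d\<in>insert k ?D. even d)"
  proof (cases "odd p")
    case False
    then have "k = 2" "p = 2" using k k2 by auto
    have "even d" if d: "d \<in> ?D" for d
    proof -
      obtain i where "d = 2 ^ i" "3 \<le> d"
        using d \<open>p = 2\<close> by (auto simp: divides_primepow_nat)
      then show ?thesis by (cases i) auto
    qed
    then show ?thesis using \<open>k = 2\<close> by simp
  qed simp
  have "residue_graph {d. d dvd p ^ \<alpha> \<and> 3 \<le> d} \<simeq> graph_copies p (residue_graph (insert k ?D))"
    using residue_graph_scale[OF p0 even] prime_power_divisors_scale[OF p _ k(1) assms(2) k3] assms(2)
    by simp
  moreover have "residue_graph (insert k ?D) \<simeq> graph_join (residue_graph ?D) (complete_graph k)"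
    using residue_graph_insert[of k ?D] k k3 by auto
  moreover have "residue_graph ?D \<simeq> nonnormal_permutability_graph (dihedral (p ^ (\<alpha> - 1)))"
    by (rule graph_iso_sym[OF nonnormal_permutability_graph_dihedral]) (use p0 in simp)
  moreover have "complete_graph k \<simeq> complete_graph k"
    by (metis card_atLeastAtMost complete_graph_def complete_graph_on_iso diff_Suc_1 finite_atLeastAtMost)
  ultimately have "residue_graph {d. d dvd p ^ \<alpha> \<and> 3 \<le> d} \<simeq>
    graph_copies p (graph_join (nonnormal_permutability_graph (dihedral (p ^ (\<alpha> - 1)))) (complete_graph k))"
    by (meson graph_copies_cong graph_iso_trans graph_join_cong)
  then show ?thesis
    using nonnormal_permutability_graph_dihedral[of "p ^ \<alpha>"] p0 graph_iso_trans by fastforce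
qed

text \<open>The primes may coincide, which covers 4 = 2 * 2.\<close>

lemma divisors_prime_mult:
  fixes p q :: nat
  assumes "prime p" "prime q"
  shows "{d. d dvd p * q} = {1, p, q, p * q}"
proof
  show "{d. d dvd p * q} \<subseteq> {1, p, q, p * q}"
  proof
    fix d assume "d \<in> {d. d dvd p * q}"
    then obtain a b where "d = a * b" "a dvd p" "b dvd q"
      using division_decomp[of d p q] by auto
    moreover have "a = 1 \<or> a = p" "b = 1 \<or> b = q"
      using calculation(2,3) assms by (simp_all add: prime_nat_iff)
    ultimately show "d \<in> {1, p, q, p * q}" by auto
  qed
qed auto

section \<open>The cases n = 4, p, 2p and pq\<close>

lemma nonnormal_permutability_graph_dihedral_4:
  "nonnormal_permutability_graph (dihedral 4) \<simeq> graph_copies 2 (complete_graph 2)"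
proof -
  have "{d. d dvd 4 \<and> 3 \<le> d} = {d \<in> {d. d dvd 2 * 2}. 3 \<le> (d :: nat)}" by auto
  also have "\<dots> = (*) 2 ` {2}"
    unfolding divisors_prime_mult[OF two_is_prime_nat two_is_prime_nat] by auto
  finally have "nonnormal_permutability_graph (dihedral 4) \<simeq> residue_graph ((*) 2 ` {2})"
    using nonnormal_permutability_graph_dihedral[of 4] by simp
  moreover have "residue_graph ((*) 2 ` {2}) \<simeq> graph_copies 2 (residue_graph {2})"
    by (rule residue_graph_scale) auto
  moreover have "residue_graph {2} \<simeq> complete_graph 2"
    using residue_graph_complete[of "{2}"] by simp
  ultimately show ?thesis by (meson graph_copies_cong graph_iso_trans)
qed

lemma nonnormal_permutability_graph_dihedral_odd_prime:
  assumes p: "prime p" "odd p"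
  shows "nonnormal_permutability_graph (dihedral p) \<simeq> edgeless_graph p"
proof -
  have "p \<ge> 3" using p prime_ge_2_nat[OF p(1)] by (cases "p = 2") auto
  then have "{d. d dvd p \<and> 3 \<le> d} = {p}" using p(1) by (auto simp: prime_nat_iff)
  then have "nonnormal_permutability_graph (dihedral p) \<simeq> residue_graph {p}"
    using nonnormal_permutability_graph_dihedral[of p] prime_gt_0_nat[OF p(1)] by simp
  then show ?thesis
    using residue_graph_odd_singleton[OF p(2)] graph_iso_trans by blast
qed

text \<open>The moduli p and 2p are p times 1 and 2, and the latter carry 1 + 2 = 3 mutually
  adjacent vertices.\<close>

lemma nonnormal_permutability_graph_dihedral_double_prime:
  assumes p: "prime p" "odd p"
  shows "nonnormal_permutability_graph (dihedral (2 * p)) \<simeq> graph_copies p (complete_graph 3)"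
proof -
  have p3: "p \<ge> 3" using p prime_ge_2_nat[OF p(1)] by (cases "p = 2") auto
  have "{d. d dvd 2 * p \<and> 3 \<le> d} = {d \<in> {d. d dvd 2 * p}. 3 \<le> d}" by auto
  also have "\<dots> = (*) p ` {1, 2}"
    unfolding divisors_prime_mult[OF two_is_prime_nat p(1)] using p3 by auto
  finally have "nonnormal_permutability_graph (dihedral (2 * p)) \<simeq> residue_graph ((*) p ` {1, 2})"
    using nonnormal_permutability_graph_dihedral[of "2 * p"] p3 by simp
  moreover have "residue_graph ((*) p ` {1, 2}) \<simeq> graph_copies p (residue_graph {1, 2})"
    by (rule residue_graph_scale) (use p p3 in auto)
  moreover have "residue_graph {1, 2} \<simeq> complete_graph 3"
    using residue_graph_complete[of "{1, 2}"] by (simp add: numeral_3_eq_3)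
  ultimately show ?thesis by (meson graph_copies_cong graph_iso_trans)
qed

lemma nonnormal_permutability_graph_dihedral_two_primes:
  assumes p: "prime p" "2 < p" and q: "prime q" "p < q"
  shows "nonnormal_permutability_graph (dihedral (p * q)) \<simeq> triangles_graph p q"
proof -
  have "{d. d dvd p * q \<and> 3 \<le> d} = {d \<in> {d. d dvd p * q}. 3 \<le> d}" by auto
  also have "\<dots> = {p, q, p * q}"
    unfolding divisors_prime_mult[OF p(1) q(1)] using p(2) q(2) mult_le_mono[of 1 p 3 q] by auto
  finally have "nonnormal_permutability_graph (dihedral (p * q)) \<simeq> residue_graph {p, q, p * q}"
    using nonnormal_permutability_graph_dihedral[of "p * q"] p q by simp
  moreover have "residue_graph {p, q, p * q} \<simeq> triangles_graph p q"
  proof (rule residue_graph_coprime)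
    show "odd p" "odd q" using p q prime_odd_nat by auto
    show "coprime p q" using p q by (simp add: primes_coprime)
  qed (use p q in auto)
  ultimately show ?thesis by (rule graph_iso_trans)
qed

theorem theorem4p5:
  shows
    "(nonnormal_permutability_graph (dihedral 4) \<simeq> graph_copies 2 (complete_graph 2) \<and>
      (\<forall>(n::nat) (\<alpha>::nat). \<alpha> \<ge> 3 \<and> n = 2 ^ \<alpha> \<longrightarrow>
        nonnormal_permutability_graph (dihedral n) \<simeq>
          graph_copies 2
            (graph_join (nonnormal_permutability_graph (dihedral (n div 2))) (complete_graph 2)))) \<and>
     (\<forall>p::nat. prime p \<and> odd p \<longrightarrow>
        nonnormal_permutability_graph (dihedral p) \<simeq> edgeless_graph p \<and>
        (\<forall>(n::nat) (\<alpha>::nat). \<alpha> \<ge> 2 \<and> n = p ^ \<alpha> \<longrightarrow>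
          nonnormal_permutability_graph (dihedral n) \<simeq>
            graph_copies p
              (graph_join (nonnormal_permutability_graph (dihedral (n div p))) (complete_graph 1)))) \<and>
     (\<forall>(n::nat) (p::nat). prime p \<and> odd p \<and> n = 2 * p \<longrightarrow>
        nonnormal_permutability_graph (dihedral n) \<simeq> graph_copies p (complete_graph 3)) \<and>
     (\<forall>(n::nat) (p::nat) (q::nat). prime p \<and> prime q \<and> 2 < p \<and> p < q \<and> n = p * q \<longrightarrow>
        nonnormal_permutability_graph (dihedral n) \<simeq> triangles_graph p q)"
proof (intro conjI allI impI; (elim conjE)?)
  show "nonnormal_permutability_graph (dihedral 4) \<simeq> graph_copies 2 (complete_graph 2)"
    by (rule nonnormal_permutability_graph_dihedral_4)
next
  fix n \<alpha> :: nat assume "3 \<le> \<alpha>" "n = 2 ^ \<alpha>"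
  then show "nonnormal_permutability_graph (dihedral n) \<simeq>
      graph_copies 2 (graph_join (nonnormal_permutability_graph (dihedral (n div 2))) (complete_graph 2))"
    \<comment> \<open>Here k = 2^1 is the largest power of 2 below 3.\<close>
    using nonnormal_permutability_graph_dihedral_prime_power[OF two_is_prime_nat, of 1 \<alpha> 2]
    by (simp add: power_diff)
next
  fix p :: nat assume "prime p" "odd p"
  then show "nonnormal_permutability_graph (dihedral p) \<simeq> edgeless_graph p"
    by (rule nonnormal_permutability_graph_dihedral_odd_prime)
next
  fix p n \<alpha> :: nat assume "prime p" "odd p" "2 \<le> \<alpha>" "n = p ^ \<alpha>"
  then show "nonnormal_permutability_graph (dihedral n) \<simeq>
      graph_copies p (graph_join (nonnormal_permutability_graph (dihedral (n div p))) (complete_graph 1))"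
    \<comment> \<open>For odd p the largest power below 3 is p^0 = 1.\<close>
    using nonnormal_permutability_graph_dihedral_prime_power[of p 0 \<alpha> 1] prime_gt_0_nat[of p]
    by (simp add: power_diff)
next
  fix n p :: nat assume "prime p" "odd p" "n = 2 * p"
  then show "nonnormal_permutability_graph (dihedral n) \<simeq> graph_copies p (complete_graph 3)"
    using nonnormal_permutability_graph_dihedral_double_prime by simp
next
  fix n p q :: nat assume "prime p" "prime q" "2 < p" "p < q" "n = p * q"
  then show "nonnormal_permutability_graph (dihedral n) \<simeq> triangles_graph p q"
    using nonnormal_permutability_graph_dihedral_two_primes by simp
qed

end
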